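(* Let $R$ be a unique factorization domain. Let $(G,\alpha)$ be a connected edge-labeled graph, $G=(V,E)$, with edge-labeling $\alpha$ by ideals of $R$ having image $\{\langle\mathsf{i}\rangle,\langle\mathsf{j}\rangle\}$. Choose an ordering $v_1,\dots,v_{|V|}$ of $V$ such that for every $1<i\le |V|$ the vertex $v_i$ is adjacent to at least one of $v_1,\dots,v_{i-1}$. For every $1<i\le|V|$ define the spline $\mathbf{b}^i$ as follows. Choose some neighbor $v_j$ of $v_i$ with $j<i$, and write $\langle\mathsf{k}\rangle:=\alpha(v_iv_j)$, where $\mathsf{k}$ is the corresponding one of the generators $\mathsf{i},\mathsf{j}$. Let $G'$ be the graph obtained from $G$ by deleting all edges $uv\in E$ with $\alpha(uv)=\langle\mathsf{k}\rangle$ (keeping all vertices), and let $C=(V',E')$ be the connected component of $G'$ containing $v_i$. (a) If $V'\subseteq\{v_i,v_{i+1},\dots,v_{|V|}\}$, then set $\mathbf{b}^i_u=\mathsf{k}$ for all $u\in V'$ and $\mathbf{b}^i_u=0$ for all $u\notin V'$. (b) Otherwise, set $\mathbf{b}^i_{v_i}=\mathrm{lcm}(\mathsf{i},\mathsf{j})$ and $\mathbf{b}^i_u=0$ for all $u\ne v_i$. Each $\mathbf{b}^i$ depends only on the ordering of the vertices in $V$ and not on the choice of the neighbor $v_j$ of $v_i$ used to define $\mathbf{b}^i$. Moreover $R_{G,\alpha}$ is a free $R$-module, and the set $\mathcal{B}=\{\mathbf{1},\mathbf{b}^2,\dots,\mathbf{b}^{|V|}\}$ is a basis for $R_{G,\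alpha}$.
   Context: Graphs are finite, with at most one edge between any two distinct vertices and no loops. An edge-labeling of a graph $G=(V,E)$ is a function $\alpha$ from $E$ to the set of ideals of a commutative ring $R$ with identity; the pair $(G,\alpha)$ is an edge-labeled graph. A (generalized) spline on $(G,\alpha)$ is a vector $\mathbf{p}=(\mathbf{p}_v)_{v\in V}\in\bigoplus_{v\in V}R$ such that $\mathbf{p}_u-\mathbf{p}_v\in\alpha(uv)$ for every edge $uv\in E$. The set $R_{G,\alpha}$ of splines is an $R$-module under coordinatewise operations. The trivial spline $\mathbf{1}$ has $\mathbf{1}_v=1$ for all $v$. The generators $\mathsf{i},\mathsf{j}\in R$ of the ideals, and a choice of $\mathrm{lcm}(\mathsf{i},\mathsf{j})$, are fixed.
   Formalization: The generators i and j are assumed nonzero; if one is zero the basis claim fails, e.g. over the integers for the path v1v2v3 with labels ⟨0⟩, ⟨2⟩, where b^2 = 0. *)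

theory Defs
  imports
    "HOL-Algebra.Ring_Divisibility"
    "Jordan_Normal_Form.Missing_VectorSpace"
begin

text \<open>Finite simple graphs: a set of vertices together with a set of two-element subsets of it.\<close>

definition simple_graph :: "'v set \<Rightarrow> 'v set set \<Rightarrow> bool" where
  "simple_graph V E \<longleftrightarrow> finite V \<and> (\<forall>e\<in>E. e \<subseteq> V \<and> card e = 2)"

definition adj_rel :: "'v set set \<Rightarrow> ('v \<times> 'v) set" where
  "adj_rel E = {(x, y). {x, y} \<in> E}"

definition component_verts :: "'v set \<Rightarrow> 'v set set \<Rightarrow> 'v \<Rightarrow> 'v set" where
  "component_verts V E x = {y \<in> V. (x, y) \<in> (adj_rel E)\<^sup>*}"

definition connected_graph :: "'v set \<Rightarrow> 'v set set \<Rightarrow> bool" where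
  "connected_graph V E \<longleftrightarrow>
     simple_graph V E \<and> V \<noteq> {} \<and> (\<forall>x\<in>V. \<forall>y\<in>V. (x, y) \<in> (adj_rel E)\<^sup>*)"

text \<open>Only the values of a labeling on \<open>E\<close> are relevant.\<close>

definition edge_labeling ::
  "('a, 'm) ring_scheme \<Rightarrow> 'v set set \<Rightarrow> ('v set \<Rightarrow> 'a set) \<Rightarrow> bool" where
  "edge_labeling R E \<alpha> \<longleftrightarrow> (\<forall>e\<in>E. ideal (\<alpha> e) R)"

definition splines ::
  "('a, 'm) ring_scheme \<Rightarrow> 'v set \<Rightarrow> 'v set set \<Rightarrow> ('v set \<Rightarrow> 'a set) \<Rightarrow> ('v \<Rightarrow> 'a) set" where
  "splines R V E \<alpha> =
     {p \<in> V \<rightarrow>\<^sub>E carrier R. \<forall>u v. {u, v} \<in> E \<longrightarrow> p u \<ominus>\<^bsub>R\<^esub> p v \<in> \<alpha> {u, v}}"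

text \<open>\<open>ring.func_space R V\<close> is the direct sum of copies of \<open>R\<close> indexed by the finite set \<open>V\<close>,
  with coordinatewise operations; its elements are \<open>undefined\<close> outside \<open>V\<close>.\<close>

definition spline_module ::
  "('a, 'm) ring_scheme \<Rightarrow> 'v set \<Rightarrow> 'v set set \<Rightarrow> ('v set \<Rightarrow> 'a set) \<Rightarrow> ('a, 'v \<Rightarrow> 'a) module" where
  "spline_module R V E \<alpha> = (ring.func_space R V)\<lparr>carrier := splines R V E \<alpha>\<rparr>"

definition one_spline :: "('a, 'm) ring_scheme \<Rightarrow> 'v set \<Rightarrow> 'v \<Rightarrow> 'a" where
  "one_spline R V = (\<lambda>u\<in>V. \<one>\<^bsub>R\<^esub>)"

definition module_basis ::
  "('a, 'm) ring_scheme \<Rightarrow> ('a, 'b, 'n) module_scheme \<Rightarrow> 'b set \<Rightarrow> bool" where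
  "module_basis R M B \<longleftrightarrow>
     B \<subseteq> carrier M \<and> \<not> module.lin_dep R M B \<and> module.span R M B = carrier M"

definition free_module ::
  "('a, 'm) ring_scheme \<Rightarrow> ('a, 'b, 'n) module_scheme \<Rightarrow> bool" where
  "free_module R M \<longleftrightarrow> module R M \<and> (\<exists>B. module_basis R M B)"

text \<open>A vertex ordering \<open>v 1, \<dots>, v (card V)\<close> (indices start at 1), and the indices of the
  neighbors of \<open>v n\<close> that precede it.\<close>

definition earlier_nbrs :: "'v set set \<Rightarrow> (nat \<Rightarrow> 'v) \<Rightarrow> nat \<Rightarrow> nat set" where
  "earlier_nbrs E v n = {m. 1 \<le> m \<and> m < n \<and> {v n, v m} \<in> E}"

definition vertex_ordering :: "'v set \<Rightarrow> 'v set set \<Rightarrow> (nat \<Rightarrow> 'v) \<Rightarrow> bool" where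
  "vertex_ordering V E v \<longleftrightarrow>
     bij_betw v {1..card V} V \<and> (\<forall>n. 1 < n \<and> n \<le> card V \<longrightarrow> earlier_nbrs E v n \<noteq> {})"

text \<open>The chosen generator of a label \<open>I\<close> equal to \<open>\<langle>i\<rangle>\<close> or \<open>\<langle>j\<rangle>\<close>. The preference for \<open>i\<close> only
  matters if \<open>\<langle>i\<rangle> = \<langle>j\<rangle>\<close>, where it makes the choice between the associates \<open>i\<close>, \<open>j\<close> uniform.\<close>

definition label_gen :: "('a, 'm) ring_scheme \<Rightarrow> 'a \<Rightarrow> 'a \<Rightarrow> 'a set \<Rightarrow> 'a" where
  "label_gen R i j I = (if I = PIdl\<^bsub>R\<^esub> i then i else j)"

text \<open>The spline at \<open>v n\<close>, constructed by means of the neighbor \<open>v m\<close>; \<open>l\<close> is the chosen least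
  common multiple of \<open>i\<close> and \<open>j\<close>.\<close>

definition basis_spline ::
  "('a, 'm) ring_scheme \<Rightarrow> 'v set \<Rightarrow> 'v set set \<Rightarrow> ('v set \<Rightarrow> 'a set) \<Rightarrow> 'a \<Rightarrow> 'a \<Rightarrow> 'a \<Rightarrow>
     (nat \<Rightarrow> 'v) \<Rightarrow> nat \<Rightarrow> nat \<Rightarrow> 'v \<Rightarrow> 'a" where
  "basis_spline R V E \<alpha> i j l v n m =
     (let k = label_gen R i j (\<alpha> {v n, v m});
          V' = component_verts V {e \<in> E. \<alpha> e \<noteq> PIdl\<^bsub>R\<^esub> k} (v n)
      in if V' \<subseteq> v ` {n..card V}
         then (\<lambda>u\<in>V. if u \<in> V' then k else \<zero>\<^bsub>R\<^esub>)
         else (\<lambda>u\<in>V. if u = v n then l else \<zero>\<^bsub>R\<^esub>))"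

end

theory Submission
  imports Defs
begin

text \<open>In the order \<open>v 1, \<dots>, v (card V)\<close> the proposed basis is triangular: \<open>b\<^sup>n\<close> vanishes at the
  vertices before \<open>v n\<close>. So it is a basis as soon as every spline \<open>p\<close> vanishing before
  \<open>v n\<close> has \<open>p (v n)\<close> divisible by the leading entry \<open>b\<^sup>n (v n) \<noteq> 0\<close>.  The edge to an earlier neighbor
  shows that \<open>k\<close> divides \<open>p (v n)\<close>, which settles case (a).  In case (b) there is also a path
  to an earlier vertex avoiding the label \<open>\<langle>k\<rangle>\<close>, so the other generator divides
  \<open>p (v n)\<close> as well, hence so does the least common multiple.  If \<open>v n\<close> has earlier neighbors with both
  labels, then (b) applies whichever of them is chosen.\<close>

section \<open>Triangular bases\<close>

text \<open>Coordinates are abstracted to linear functionals so that the triangularity argument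
  works in an arbitrary module; the instances used are the evaluations of splines at
  vertices.\<close>

definition linear_functional ::
  "('a, 'm) ring_scheme \<Rightarrow> ('a, 'b, 'n) module_scheme \<Rightarrow> ('b \<Rightarrow> 'a) \<Rightarrow> bool" where
  "linear_functional R M f \<longleftrightarrow> f \<in> carrier M \<rightarrow> carrier R \<and>
     (\<forall>x\<in>carrier M. \<forall>y\<in>carrier M. f (x \<oplus>\<^bsub>M\<^esub> y) = f x \<oplus>\<^bsub>R\<^esub> f y) \<and>
     (\<forall>c\<in>carrier R. \<forall>x\<in>carrier M. f (c \<odot>\<^bsub>M\<^esub> x) = c \<otimes>\<^bsub>R\<^esub> f x)"

context module
begin

lemma linear_functional_closed:
  "linear_functional R M f \<Longrightarrow> x \<in> carrier M \<Longrightarrow> f x \<in> carrier R"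
  by (auto simp: linear_functional_def)

lemma linear_functional_add:
  "linear_functional R M f \<Longrightarrow> x \<in> carrier M \<Longrightarrow> y \<in> carrier M \<Longrightarrow> f (x \<oplus>\<^bsub>M\<^esub> y) = f x \<oplus> f y"
  by (auto simp: linear_functional_def)

lemma linear_functional_smult:
  "linear_functional R M f \<Longrightarrow> c \<in> carrier R \<Longrightarrow> x \<in> carrier M \<Longrightarrow> f (c \<odot>\<^bsub>M\<^esub> x) = c \<otimes> f x"
  by (auto simp: linear_functional_def)

lemma linear_functional_zero:
  assumes "linear_functional R M f"
  shows "f \<zero>\<^bsub>M\<^esub> = \<zero>"
proof -
  have "f (\<zero> \<odot>\<^bsub>M\<^esub> \<zero>\<^bsub>M\<^esub>) = \<zero> \<otimes> f \<zero>\<^bsub>M\<^esub>"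
    by (rule linear_functional_smult[OF assms]) auto
  then show ?thesis
    using linear_functional_closed[OF assms M.zero_closed] by simp
qed

text \<open>Serves to isolate one term in the independence proof. A term dies either because its
  coefficient is zero or because the functional kills its vector, hence the condition on the
  product.\<close>

lemma linear_functional_lincomb_eq_zero:
  assumes f: "linear_functional R M f"
    and "finite A" "A \<subseteq> carrier M" "a \<in> A \<rightarrow> carrier R"
    and "\<And>x. x \<in> A \<Longrightarrow> a x \<otimes> f x = \<zero>"
  shows "f (lincomb a A) = \<zero>"
  using assms(2-)
proof (induction A rule: finite_induct)
  case empty
  then show ?case
    using linear_functional_zero[OF f] by (simp add: lincomb_def)
next
  case (insert x A)
  have "lincomb a (insert x A) = a x \<odot>\<^bsub>M\<^esub> x \<oplus>\<^bsub>M\<^esub> lincomb a A"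
    using lincomb_insert[of A a x] insert by auto
  moreover have "lincomb a A \<in> carrier M"
    using insert by (intro lincomb_closed) auto
  ultimately show ?case
    using insert by (simp add: linear_functional_add[OF f] linear_functional_smult[OF f])
qed

text \<open>In a vanishing combination, apply \<open>f n\<close> for the least index
  \<open>n\<close> with nonzero coefficient: terms of smaller index have coefficient zero, terms of
  larger index are killed by \<open>lower\<close>. What remains is
  \<open>a (b n) \<otimes> f n (b n)\<close>, a nonzero product in a domain.\<close>

lemma triangular_lin_indpt:
  fixes b :: "nat \<Rightarrow> 'c"
  assumes "domain R"
    and lin: "\<And>n. n \<in> I \<Longrightarrow> linear_functional R M (f n)"
    and b: "b ` I \<subseteq> carrier M"
    and lower: "\<And>m n. m \<in> I \<Longrightarrow> n \<in> I \<Longrightarrow> m < n \<Longrightarrow> f m (b n) = \<zero>"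
    and diag: "\<And>n. n \<in> I \<Longrightarrow> f n (b n) \<noteq> \<zero>"
  shows "\<not> lin_dep (b ` I)"
proof
  interpret domain R by fact
  assume "lin_dep (b ` I)"
  then obtain A a x where A: "finite A" "A \<subseteq> b ` I" and a: "a \<in> A \<rightarrow> carrier R"
    and comb: "lincomb a A = \<zero>\<^bsub>M\<^esub>" and x: "x \<in> A" "a x \<noteq> \<zero>"
    unfolding lin_dep_def by blast
  let ?P = "\<lambda>n. n \<in> I \<and> b n \<in> A \<and> a (b n) \<noteq> \<zero>"
  define n where "n = (LEAST n. ?P n)"
  have "\<exists>n. ?P n" using A x by auto
  then have n: "?P n" unfolding n_def by (rule LeastI_ex)
  have least: "m < n \<Longrightarrow> \<not> ?P m" for m unfolding n_def by (rule not_less_Least)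
  note fn = lin[of n]
  have AM: "A \<subseteq> carrier M" using A b by auto
  have "f n (lincomb a (A - {b n})) = \<zero>"
  proof (rule linear_functional_lincomb_eq_zero)
    fix y assume y: "y \<in> A - {b n}"
    then obtain m where m: "m \<in> I" "y = b m" using A by auto
    have "a y = \<zero> \<or> f n y = \<zero>"
      using m n y least[of m] lower[of n m] by (cases m n rule: linorder_cases) auto
    then show "a y \<otimes> f n y = \<zero>"
      using y AM funcset_mem[OF a, of y] linear_functional_closed[OF fn, of y] n by auto
  qed (use n fn A AM a in auto)
  moreover have "lincomb a (A - {b n}) \<in> carrier M"
    using A AM a by (intro lincomb_closed) auto
  moreover have bn: "b n \<in> carrier M" "a (b n) \<in> carrier R" "f n (b n) \<in> carrier R"
    using n b a linear_functional_closed[OF fn] by auto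
  ultimately have "f n (lincomb a A) = a (b n) \<otimes> f n (b n)"
    using lincomb_del2[of A a "b n"] A AM a n
    by (simp add: linear_functional_add[OF fn] linear_functional_smult[OF fn])
  then have "a (b n) \<otimes> f n (b n) = \<zero>"
    using comb linear_functional_zero[OF fn] n by simp
  then show False
    using integral_iff[OF bn(2,3)] n diag by auto
qed

text \<open>Elimination: by \<open>lead\<close>, subtracting a suitable multiple of
  \<open>b n\<close> clears coordinate \<open>n\<close>, and by \<open>lower\<close> the earlier
  coordinates stay zero. Once all coordinates vanish, \<open>sep\<close> applies.\<close>

lemma triangular_span:
  fixes b :: "nat \<Rightarrow> 'c"
  assumes lin: "\<And>n. n \<in> {1..N} \<Longrightarrow> linear_functional R M (f n)"
    and sep: "\<And>x. x \<in> carrier M \<Longrightarrow> (\<And>n. n \<in> {1..N} \<Longrightarrow> f n x = \<zero>) \<Longrightarrow> x = \<zero>\<^bsub>M\<^esub>"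
    and b: "b ` {1..N} \<subseteq> carrier M"
    and lower: "\<And>m n. m \<in> {1..N} \<Longrightarrow> n \<in> {1..N} \<Longrightarrow> m < n \<Longrightarrow> f m (b n) = \<zero>"
    and lead: "\<And>x n. x \<in> carrier M \<Longrightarrow> n \<in> {1..N} \<Longrightarrow> (\<And>m. m \<in> {1..<n} \<Longrightarrow> f m x = \<zero>)
                 \<Longrightarrow> f n x \<in> PIdl (f n (b n))"
  shows "span (b ` {1..N}) = carrier M"
proof
  show "span (b ` {1..N}) \<subseteq> carrier M"
    using b by (rule span_is_subset2)
next
  interpret S: LinearCombinations.submodule R "span (b ` {1..N})" M
    using b by (rule span_is_submodule)
  \<comment> \<open>Descending induction on \<open>n\<close> from \<open>Suc N\<close>, where all
    coordinates vanish; at \<open>n = 1\<close> the vanishing condition is void.\<close>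
  have "x \<in> span (b ` {1..N})"
    if "x \<in> carrier M" "1 \<le> n" "n \<le> Suc N" "\<And>m. m \<in> {1..<n} \<Longrightarrow> f m x = \<zero>" for x n
    using that(3,2,1,4)
  proof (induction n arbitrary: x rule: inc_induct)
    case base
    then have "x = \<zero>\<^bsub>M\<^esub>" by (intro sep) auto
    then show ?case using S.zero_closed by (simp only:)
  next
    case (step n)
    then have n: "n \<in> {1..N}" by simp
    note fn = lin[OF n]
    have bn: "b n \<in> carrier M" using b n by auto
    from lead[OF step.prems(2) n step.prems(3)]
    obtain c where c: "c \<in> carrier R" "f n x = c \<otimes> f n (b n)"
      by (auto simp: cgenideal_def)
    let ?y = "x \<oplus>\<^bsub>M\<^esub> (\<ominus> c) \<odot>\<^bsub>M\<^esub> b n"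
    have y: "?y \<in> carrier M" using step.prems bn c by auto
    have "f m ?y = \<zero>" if m: "m \<in> {1..<Suc n}" for m
    proof -
      have fm: "linear_functional R M (f m)" using m n by (intro lin) auto
      have fb: "f m (b n) \<in> carrier R" using linear_functional_closed[OF fm bn] .
      have "f m ?y = f m x \<oplus> (\<ominus> c) \<otimes> f m (b n)"
        using step.prems bn c
        by (simp add: linear_functional_add[OF fm] linear_functional_smult[OF fm])
      also have "\<dots> = \<zero>"
      proof (cases "m = n")
        case True
        then show ?thesis using c fb by (simp add: R.l_minus R.r_neg)
      next
        case False
        then show ?thesis using m n c step.prems(3)[of m] lower[of m n] by auto
      qed
      finally show ?thesis .
    qed
    then have "?y \<in> span (b ` {1..N})"
      using y by (intro step.IH) auto
    moreover have "c \<odot>\<^bsub>M\<^esub> b n \<in> span (b ` {1..N})"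
      using in_own_span[OF b] n by (intro S.smult_closed[OF c(1)]) blast
    ultimately have "?y \<oplus>\<^bsub>M\<^esub> c \<odot>\<^bsub>M\<^esub> b n \<in> span (b ` {1..N})" by (rule S.m_closed)
    also have "?y \<oplus>\<^bsub>M\<^esub> c \<odot>\<^bsub>M\<^esub> b n = x"
      using step.prems bn c by (simp add: M.a_assoc smult_l_minus M.l_neg)
    finally show ?case .
  qed
  from this[of _ 1] show "carrier M \<subseteq> span (b ` {1..N})" by auto
qed

lemma triangular_basis:
  fixes b :: "nat \<Rightarrow> 'c"
  assumes "domain R"
    and "\<And>n. n \<in> {1..N} \<Longrightarrow> linear_functional R M (f n)"
    and "\<And>x. x \<in> carrier M \<Longrightarrow> (\<And>n. n \<in> {1..N} \<Longrightarrow> f n x = \<zero>) \<Longrightarrow> x = \<zero>\<^bsub>M\<^esub>"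
    and "b ` {1..N} \<subseteq> carrier M"
    and "\<And>m n. m \<in> {1..N} \<Longrightarrow> n \<in> {1..N} \<Longrightarrow> m < n \<Longrightarrow> f m (b n) = \<zero>"
    and "\<And>n. n \<in> {1..N} \<Longrightarrow> f n (b n) \<noteq> \<zero>"
    and "\<And>x n. x \<in> carrier M \<Longrightarrow> n \<in> {1..N} \<Longrightarrow> (\<And>m. m \<in> {1..<n} \<Longrightarrow> f m x = \<zero>)
           \<Longrightarrow> f n x \<in> PIdl (f n (b n))"
  shows "module_basis R M (b ` {1..N})"
  unfolding module_basis_def
  using assms(4) triangular_lin_indpt[OF assms(1,2,4,5,6)] triangular_span[OF assms(2,3,4,5,7)]
  by blast

end

section \<open>The module of splines\<close>

lemma (in ring) carrier_spline_module [simp]: "carrier (spline_module R V E \<alpha>) = splines R V E \<alpha>"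
  by (simp add: spline_module_def)

lemma (in ring) spline_module_ops [simp]:
  "x \<oplus>\<^bsub>spline_module R V E \<alpha>\<^esub> y = (\<lambda>u\<in>V. x u \<oplus> y u)"
  "c \<odot>\<^bsub>spline_module R V E \<alpha>\<^esub> x = (\<lambda>u\<in>V. c \<otimes> x u)"
  "\<zero>\<^bsub>spline_module R V E \<alpha>\<^esub> = (\<lambda>u\<in>V. \<zero>)"
  by (simp_all add: spline_module_def func_space_def)

lemma splines_closed: "p \<in> splines R V E \<alpha> \<Longrightarrow> u \<in> V \<Longrightarrow> p u \<in> carrier R"
  by (auto simp: splines_def)

lemma splines_edge: "p \<in> splines R V E \<alpha> \<Longrightarrow> {u, w} \<in> E \<Longrightarrow> p u \<ominus>\<^bsub>R\<^esub> p w \<in> \<alpha> {u, w}"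
  by (auto simp: splines_def)

lemma simple_graph_edgeD: "simple_graph V E \<Longrightarrow> {u, w} \<in> E \<Longrightarrow> u \<in> V \<and> w \<in> V"
  by (auto simp: simple_graph_def)

lemma (in cring) mem_PIdl_iff:
  assumes "a \<in> carrier R"
  shows "x \<in> PIdl a \<longleftrightarrow> x \<in> carrier R \<and> a divides x"
  unfolding cgenideal_def factor_def using assms m_comm[OF assms] by (auto; metis m_closed)

lemma (in ring) ideal_mem_of_minus:
  assumes "ideal I R" "x \<ominus> y \<in> I" "y \<in> I" "x \<in> carrier R"
  shows "x \<in> I"
proof -
  interpret ideal I R by fact
  have "x \<ominus> y \<oplus> y \<in> I" using assms by auto
  also have "x \<ominus> y \<oplus> y = x" using assms by (simp add: minus_eq a_assoc l_neg Icarr)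
  finally show ?thesis .
qed

text \<open>Each edge of \<open>F\<close> puts a difference of values into \<open>I\<close>, so
  membership passes from \<open>y\<close> back to \<open>x\<close> edge by edge. It is applied with
  an earlier vertex \<open>y\<close> at which the spline vanishes.\<close>

lemma (in ring) spline_mem_ideal_along_path:
  assumes "simple_graph V E" "p \<in> splines R V E \<alpha>" "ideal I R"
    and F: "F \<subseteq> E" "\<And>e. e \<in> F \<Longrightarrow> \<alpha> e = I"
    and path: "(x, y) \<in> (adj_rel F)\<^sup>*" and "p y \<in> I"
  shows "p x \<in> I"
  using path
proof (induction rule: converse_rtrancl_induct)
  case base
  show ?case by fact
next
  case (step u w)
  then have "{u, w} \<in> F" by (simp add: adj_rel_def)
  moreover from this have "{u, w} \<in> E" using F by auto
  ultimately have "p u \<ominus> p w \<in> I" "p u \<in> carrier R"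
    using splines_edge[OF assms(2)] splines_closed[OF assms(2)] F simple_graph_edgeD[OF assms(1)]
    by fastforce+
  then show ?case using ideal_mem_of_minus[OF assms(3)] step.IH by blast
qed

text \<open>Splines form a submodule of the full function space: differences of sums regroup into
  sums of differences, scalars factor out, and every label is an ideal.\<close>

lemma (in cring) spline_module_is_module:
  assumes G: "simple_graph V E" and lab: "edge_labeling R E \<alpha>"
  shows "module R (spline_module R V E \<alpha>)"
proof -
  interpret F: module R "func_space V" by (rule func_space_is_module)
  have "LinearCombinations.submodule R (splines R V E \<alpha>) (func_space V)"
  proof
    show "splines R V E \<alpha> \<subseteq> carrier (func_space V)"
      by (auto simp: splines_def func_space_def)
  next
    fix p q assume p: "p \<in> splines R V E \<alpha>" and q: "q \<in> splines R V E \<alpha>"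
    have "(p u \<oplus> q u) \<ominus> (p w \<oplus> q w) \<in> \<alpha> {u, w}" if e: "{u, w} \<in> E" for u w
    proof -
      interpret I: ideal "\<alpha> {u, w}" R using lab e by (auto simp: edge_labeling_def)
      have "p u \<in> carrier R" "q u \<in> carrier R" "p w \<in> carrier R" "q w \<in> carrier R"
        using simple_graph_edgeD[OF G e] p q splines_closed by auto
      then have "(p u \<oplus> q u) \<ominus> (p w \<oplus> q w) = (p u \<ominus> p w) \<oplus> (q u \<ominus> q w)"
        by algebra
      then show ?thesis using splines_edge[OF p e] splines_edge[OF q e] by auto
    qed
    then show "p \<oplus>\<^bsub>func_space V\<^esub> q \<in> splines R V E \<alpha>"
      using p q simple_graph_edgeD[OF G]
      by (auto simp: splines_def func_space_def PiE_iff)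
  next
    show "\<zero>\<^bsub>func_space V\<^esub> \<in> splines R V E \<alpha>"
      using simple_graph_edgeD[OF G] lab
      by (auto simp: splines_def func_space_def minus_eq edge_labeling_def
          ideal_def additive_subgroup.zero_closed)
  next
    fix c p assume c: "c \<in> carrier R" and p: "p \<in> splines R V E \<alpha>"
    have "c \<otimes> p u \<ominus> c \<otimes> p w \<in> \<alpha> {u, w}" if e: "{u, w} \<in> E" for u w
    proof -
      interpret I: ideal "\<alpha> {u, w}" R using lab e by (auto simp: edge_labeling_def)
      have "p u \<in> carrier R" "p w \<in> carrier R"
        using simple_graph_edgeD[OF G e] p splines_closed by auto
      then have "c \<otimes> p u \<ominus> c \<otimes> p w = c \<otimes> (p u \<ominus> p w)"
        using c by algebra
      then show ?thesis using splines_edge[OF p e] c I.I_l_closed by auto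
    qed
    then show "c \<odot>\<^bsub>func_space V\<^esub> p \<in> splines R V E \<alpha>"
      using c p simple_graph_edgeD[OF G]
      by (auto simp: splines_def func_space_def PiE_iff)
  qed
  then show ?thesis
    unfolding spline_module_def by (rule F.submodule_is_module)
qed

lemma (in cring) linear_functional_eval:
  assumes "u \<in> V"
  shows "linear_functional R (spline_module R V E \<alpha>) (\<lambda>p. p u)"
  using assms by (auto simp: linear_functional_def splines_closed)

lemma (in cring) one_spline_mem:
  assumes "simple_graph V E" "edge_labeling R E \<alpha>"
  shows "one_spline R V \<in> splines R V E \<alpha>"
  using simple_graph_edgeD[OF assms(1)] assms(2)
  by (auto simp: splines_def one_spline_def r_neg minus_eq edge_labeling_def
      ideal_def additive_subgroup.zero_closed)

section \<open>Two labels\<close>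

locale two_labels = domain R for R (structure) +
  fixes V :: "'v set" and E :: "'v set set" and \<alpha> :: "'v set \<Rightarrow> 'a set"
    and i j l :: 'a and v :: "nat \<Rightarrow> 'v"
  assumes graph: "simple_graph V E"
    and labeling: "edge_labeling R E \<alpha>"
    and i: "i \<in> carrier R" "i \<noteq> \<zero>" and j: "j \<in> carrier R" "j \<noteq> \<zero>"
    and labels: "\<alpha> ` E \<subseteq> {PIdl i, PIdl j}"
    and l: "l \<in> carrier R" "l lcmof i j"
    and ordering: "vertex_ordering V E v"
begin

abbreviation "gen e \<equiv> label_gen R i j (\<alpha> e)"
abbreviation "bspline \<equiv> basis_spline R V E \<alpha> i j l v"
text \<open>The vertex set \<open>V'\<close> of the construction at \<open>v n\<close>, when the
  edges labeled by the ideal of \<open>k\<close> are deleted.\<close>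

abbreviation "kcomp n k \<equiv> component_verts V {e \<in> E. \<alpha> e \<noteq> PIdl k} (v n)"

section \<open>Labels, their generators and the least common multiple\<close>

lemma gen_cases: "gen e \<in> {i, j}"
  by (simp add: label_gen_def)

lemma gen_closed: "gen e \<in> carrier R" and gen_nonzero: "gen e \<noteq> \<zero>"
  using gen_cases[of e] i j by auto

lemma label_cases:
  assumes "e \<in> E"
  shows "\<alpha> e = PIdl i \<or> \<alpha> e = PIdl j"
  using labels assms by blast

text \<open>This covers coinciding ideals too: \<open>label_gen\<close> then returns
  \<open>i\<close>, which generates the common label.\<close>

lemma PIdl_gen: "e \<in> E \<Longrightarrow> PIdl (gen e) = \<alpha> e"
  using label_cases[of e] by (cases "\<alpha> e = PIdl i") (simp_all add: label_gen_def)

text \<open>The nonzero product \<open>i \<otimes> j\<close> is a common multiple, so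
  \<open>l = \<zero>\<close> would have to divide it.\<close>

lemma l_nonzero: "l \<noteq> \<zero>"
proof
  assume "l = \<zero>"
  moreover have "i divides i \<otimes> j" "j divides i \<otimes> j"
    using i j by (auto intro: dividesI' m_comm)
  ultimately have "\<zero> divides i \<otimes> j"
    using l i j by (simp add: islcm_def)
  then show False
    using i j by (simp add: factor_def integral_iff)
qed

text \<open>A common multiple lies in both principal ideals. Hence the value \<open>l\<close> at a
  single vertex violates no edge condition, as case (b) requires.\<close>

lemma l_mem_label:
  assumes "e \<in> E"
  shows "l \<in> \<alpha> e"
proof -
  have "l \<in> PIdl i" "l \<in> PIdl j"
    using l i j by (simp_all add: islcm_def mem_PIdl_iff)
  then show ?thesis using label_cases[OF assms] by metis
qed

text \<open>The defining minimality of \<open>l\<close> merges the two divisibilities obtained in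
  case (b) into one.\<close>

lemma mem_PIdl_l:
  assumes "x \<in> PIdl i" "x \<in> PIdl j"
  shows "x \<in> PIdl l"
proof -
  have "x \<in> carrier R" "i divides x" "j divides x"
    using assms by (simp_all add: mem_PIdl_iff i j)
  moreover have "\<forall>y\<in>carrier R. i divides y \<and> j divides y \<longrightarrow> l divides y"
    using l(2) by (simp add: islcm_def)
  ultimately show ?thesis by (simp add: mem_PIdl_iff l(1))
qed

section \<open>The vertex ordering and the components left after deleting a label\<close>

lemma v_bij: "bij_betw v {1..card V} V"
  using ordering by (simp add: vertex_ordering_def)

lemma v_mem: "n \<in> {1..card V} \<Longrightarrow> v n \<in> V"
  using bij_betwE[OF v_bij] by blast

lemma v_eq_iff: "n \<in> {1..card V} \<Longrightarrow> m \<in> {1..card V} \<Longrightarrow> v n = v m \<longleftrightarrow> n = m"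
  by (rule inj_on_eq_iff[OF bij_betw_imp_inj_on[OF v_bij]])

text \<open>Injectivity of the ordering turns the condition of case (a) into a comparison of
  indices.\<close>

lemma v_mem_image_iff:
  assumes "m \<in> {1..card V}" "1 \<le> n"
  shows "v m \<in> v ` {n..card V} \<longleftrightarrow> n \<le> m"
proof -
  have "{n..card V} \<subseteq> {1..card V}" using assms by simp
  from inj_on_image_mem_iff[OF bij_betw_imp_inj_on[OF v_bij] assms(1) this]
  show ?thesis using assms by simp
qed

lemma self_mem_comp: "n \<in> {1..card V} \<Longrightarrow> v n \<in> kcomp n k"
  by (simp add: component_verts_def v_mem)

text \<open>A surviving edge extends paths in both directions. In contrapositive form: an edge with
  exactly one end in the component carries the label \<open>PIdl k\<close>.\<close>

lemma comp_edge_iff: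
  assumes "{u, w} \<in> E" "\<alpha> {u, w} \<noteq> PIdl k"
  shows "u \<in> kcomp n k \<longleftrightarrow> w \<in> kcomp n k"
proof -
  let ?r = "adj_rel {e \<in> E. \<alpha> e \<noteq> PIdl k}"
  have "(u, w) \<in> ?r" "(w, u) \<in> ?r"
    using assms by (simp_all add: adj_rel_def insert_commute[of w u])
  then have "(v n, u) \<in> ?r\<^sup>* \<longleftrightarrow> (v n, w) \<in> ?r\<^sup>*"
    by (blast intro: rtrancl_into_rtrancl)
  then show ?thesis
    using simple_graph_edgeD[OF graph assms(1)] by (simp add: component_verts_def)
qed

section \<open>The constructed splines: edge conditions, triangular shape, divisibility and
  independence of the neighbor\<close>

lemma bspline_mem:
  assumes n: "n \<in> {1..card V}" and m: "m \<in> earlier_nbrs E v n"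
  shows "bspline n m \<in> splines R V E \<alpha>"
proof -
  let ?k = "gen {v n, v m}"
  let ?a = "\<lambda>u\<in>V. if u \<in> kcomp n ?k then ?k else \<zero>"
  let ?b = "\<lambda>u\<in>V. if u = v n then l else \<zero>"
  have "?a \<in> splines R V E \<alpha>"
    unfolding splines_def
  proof (intro CollectI conjI allI impI)
    fix u w assume e: "{u, w} \<in> E"
    interpret I: ideal "\<alpha> {u, w}" R using labeling e by (auto simp: edge_labeling_def)
    \<comment> \<open>Only an edge crossing the boundary of the component gives a nonzero
      difference, and such an edge was deleted, so its label contains \<open>?k\<close>.\<close>
    have "?k \<in> \<alpha> {u, w}" if "(u \<in> kcomp n ?k) \<noteq> (w \<in> kcomp n ?k)"
    proof -
      have "\<alpha> {u, w} = PIdl ?k" using comp_edge_iff[OF e, of ?k n] that by blast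
      then show ?thesis using cgenideal_self[OF gen_closed[of "{v n, v m}"]] by simp
    qed
    then show "?a u \<ominus> ?a w \<in> \<alpha> {u, w}"
      using simple_graph_edgeD[OF graph e] gen_closed by (auto simp: minus_eq r_neg)
  qed (use gen_closed in auto)
  moreover have "?b \<in> splines R V E \<alpha>"
    unfolding splines_def
  proof (intro CollectI conjI allI impI)
    fix u w assume e: "{u, w} \<in> E"
    interpret I: ideal "\<alpha> {u, w}" R using labeling e by (auto simp: edge_labeling_def)
    have "?b u \<in> \<alpha> {u, w}" "?b w \<in> \<alpha> {u, w}"
      using simple_graph_edgeD[OF graph e] l_mem_label[OF e] I.zero_closed by auto
    then show "?b u \<ominus> ?b w \<in> \<alpha> {u, w}"
      unfolding minus_eq by (intro I.a_closed I.a_inv_closed)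
  qed (use l in auto)
  ultimately show ?thesis
    by (simp add: basis_spline_def Let_def)
qed

text \<open>The support is contained in a component made up of \<open>v n\<close> and later vertices
  in case (a), and in \<open>{v n}\<close> in case (b).\<close>

lemma bspline_at_earlier:
  assumes "n \<in> {1..card V}" "m' \<in> {1..<n}"
  shows "bspline n m (v m') = \<zero>"
proof -
  have m': "m' \<in> {1..card V}" using assms by auto
  then have "v m' \<notin> v ` {n..card V}" "v m' \<noteq> v n" "v m' \<in> V"
    using assms v_mem_image_iff[of m' n] v_eq_iff[of m' n] v_mem by auto
  then show ?thesis
    by (auto simp: basis_spline_def Let_def)
qed

lemma bspline_diag:
  assumes "n \<in> {1..card V}"
  shows "bspline n m (v n) =
    (if kcomp n (gen {v n, v m}) \<subseteq> v ` {n..card V} then gen {v n, v m} else l)"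
  using v_mem[OF assms] self_mem_comp[OF assms] by (simp add: basis_spline_def Let_def)

text \<open>Supplies the leading-entry condition of \<open>triangular_basis\<close> at every vertex
  with an earlier neighbor.\<close>

lemma spline_lead_dvd:
  assumes n: "n \<in> {1..card V}" and m: "m \<in> earlier_nbrs E v n"
    and p: "p \<in> splines R V E \<alpha>" and vanish: "\<And>m. m \<in> {1..<n} \<Longrightarrow> p (v m) = \<zero>"
  shows "p (v n) \<in> PIdl (bspline n m (v n))"
proof -
  let ?k = "gen {v n, v m}"
  have e: "{v n, v m} \<in> E" and "p (v m) = \<zero>"
    using m vanish by (auto simp: earlier_nbrs_def)
  \<comment> \<open>Since \<open>p (v m)\<close> is zero, the edge condition concerns
    \<open>p (v n)\<close> alone.\<close>
  then have k: "p (v n) \<in> PIdl ?k"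
    using splines_edge[OF p e] splines_closed[OF p v_mem[OF n]] PIdl_gen[OF e]
    by (simp add: minus_eq)
  show ?thesis
  proof (cases "kcomp n ?k \<subseteq> v ` {n..card V}")
    case True
    then show ?thesis using k by (simp add: bspline_diag[OF n])
  next
    case False
    let ?F = "{e \<in> E. \<alpha> e \<noteq> PIdl ?k}"
    \<comment> \<open>Failure of case (a) yields a vertex \<open>w\<close> of the component that
      precedes \<open>v n\<close>, so \<open>p\<close> vanishes there.\<close>
    from False obtain w where w: "w \<in> V" "w \<notin> v ` {n..card V}" "(v n, w) \<in> (adj_rel ?F)\<^sup>*"
      by (auto simp: component_verts_def)
    then obtain m' where m': "w = v m'" "m' \<in> {1..card V}"
      using bij_betw_imp_surj_on[OF v_bij] by blast
    with w n have "p w = \<zero>"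
      by (intro vanish[of m', folded m'(1)]) (auto simp: not_le)
    \<comment> \<open>A generator of \<open>PIdl ?k\<close> is settled by \<open>k\<close>. For the
      other one, the surviving edges all carry the label \<open>PIdl x\<close>, as there are only
      two labels, and the path to \<open>w\<close> transports membership. If both ideals coincide,
      only the first alternative occurs.\<close>
    have "p (v n) \<in> PIdl x" if x: "x \<in> {i, j}" for x
    proof (cases "PIdl x = PIdl ?k")
      case True
      then show ?thesis using k by simp
    next
      case False
      have I: "ideal (PIdl x) R" using x i j by (auto intro: cgenideal_ideal)
      have "\<alpha> e = PIdl x" if "e \<in> ?F" for e
      proof -
        have "e \<in> E" "\<alpha> e \<noteq> PIdl ?k" using that by auto
        moreover have "PIdl x = PIdl i \<or> PIdl x = PIdl j"
          using x by (elim insertE) simp_all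
        ultimately show ?thesis
          using label_cases[of e] label_cases[OF e] PIdl_gen[OF e] False by argo
      qed
      moreover have "p w \<in> PIdl x"
        using I \<open>p w = \<zero>\<close> by (simp add: ideal_def additive_subgroup.zero_closed)
      ultimately show ?thesis
        using spline_mem_ideal_along_path[OF graph p I, of ?F] w(3) by blast
    qed
    then show ?thesis
      using False mem_PIdl_l by (simp add: bspline_diag[OF n])
  qed
qed

text \<open>The neighbor enters the definition only through its label. If the labels differ, the
  edge to either neighbor survives the deletion made for the other, so the component reaches an
  earlier vertex. Both choices then fall under case (b), whose spline does not mention the
  neighbor.\<close>

lemma bspline_unique:
  assumes n: "n \<in> {1..card V}"
    and m: "m \<in> earlier_nbrs E v n" and m': "m' \<in> earlier_nbrs E v n"
  shows "bspline n m = bspline n m'"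
proof (cases "\<alpha> {v n, v m} = \<alpha> {v n, v m'}")
  case True
  then show ?thesis by (simp add: basis_spline_def)
next
  case False
  have "\<not> kcomp n (gen {v n, v q}) \<subseteq> v ` {n..card V}"
    if q: "q \<in> earlier_nbrs E v n" and r: "r \<in> earlier_nbrs E v n"
      and ne: "\<alpha> {v n, v q} \<noteq> \<alpha> {v n, v r}" for q r
  proof -
    have q: "{v n, v q} \<in> E" and e: "{v n, v r} \<in> E" and r: "r \<in> {1..card V}" "r < n"
      using q r n by (auto simp: earlier_nbrs_def)
    then have "v r \<in> kcomp n (gen {v n, v q})"
      using comp_edge_iff[OF e, of "gen {v n, v q}" n]
        self_mem_comp[OF n, of "gen {v n, v q}"] ne
      by (simp add: PIdl_gen[OF q])
    moreover have "v r \<notin> v ` {n..card V}"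
      using r n v_mem_image_iff[of r n] by simp
    ultimately show ?thesis by blast
  qed
  from this[OF m m' False] this[OF m' m] False show ?thesis
    by (simp add: basis_spline_def)
qed

text \<open>The triangular criterion is applied to the evaluations at \<open>v 1\<close>, ...,
  \<open>v (card V)\<close>, for an arbitrary choice \<open>nb\<close> of earlier neighbors.\<close>

lemma bspline_basis:
  assumes nb: "\<And>n. 1 < n \<Longrightarrow> n \<le> card V \<Longrightarrow> nb n \<in> earlier_nbrs E v n" and "V \<noteq> {}"
  shows "module_basis R (spline_module R V E \<alpha>)
    (insert (one_spline R V) {bspline n (nb n) | n. 1 < n \<and> n \<le> card V})"
proof -
  interpret M: module R "spline_module R V E \<alpha>"
    using graph labeling by (rule spline_module_is_module)
  \<comment> \<open>The trivial spline takes the free index 1, so that basis vectors and vertices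
    share one index set.\<close>
  define b where "b n = (if n = 1 then one_spline R V else bspline n (nb n))" for n
  have one: "one_spline R V (v n) = \<one>" if "n \<in> {1..card V}" for n
    using that by (simp add: one_spline_def v_mem)
  \<comment> \<open>Guarantees that index 1 occurs, so that the trivial spline belongs to the image
    of \<open>b\<close>.\<close>
  have "card V \<ge> 1"
    using assms(2) graph by (simp add: simple_graph_def Suc_le_eq card_gt_0_iff)
  then have "insert (one_spline R V) {bspline n (nb n) | n. 1 < n \<and> n \<le> card V} = b ` {1..card V}"
    by (force simp: b_def)
  moreover have "module_basis R (spline_module R V E \<alpha>) (b ` {1..card V})"
  proof (rule M.triangular_basis[where f = "\<lambda>n p. p (v n)"])
    show "domain R" by (rule domain_axioms)
  next
    fix n assume "n \<in> {1..card V}"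
    then show "linear_functional R (spline_module R V E \<alpha>) (\<lambda>p. p (v n))"
      by (intro linear_functional_eval v_mem)
  next
    fix p assume p: "p \<in> carrier (spline_module R V E \<alpha>)"
      and zero: "\<And>n. n \<in> {1..card V} \<Longrightarrow> p (v n) = \<zero>"
    have "\<forall>u\<in>v ` {1..card V}. p u = \<zero>"
      using zero by (intro ballI) (erule imageE, simp)
    then have "\<forall>u\<in>V. p u = \<zero>"
      by (simp only: bij_betw_imp_surj_on[OF v_bij])
    \<comment> \<open>Extensionality fixes the values outside \<open>V\<close>, so vanishing on
      \<open>V\<close> gives equality with the zero spline.\<close>
    moreover have "p \<in> extensional V"
      using p by (simp add: splines_def PiE_iff)
    ultimately show "p = \<zero>\<^bsub>spline_module R V E \<alpha>\<^esub>"
      by (auto simp: extensional_def fun_eq_iff)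
  next
    show "b ` {1..card V} \<subseteq> carrier (spline_module R V E \<alpha>)"
    proof (rule image_subsetI)
      fix n assume "n \<in> {1..card V}"
      then show "b n \<in> carrier (spline_module R V E \<alpha>)"
        using one_spline_mem[OF graph labeling] bspline_mem[of n "nb n"] nb[of n]
        by (simp add: b_def)
    qed
  next
    fix m n assume "m \<in> {1..card V}" "n \<in> {1..card V}" "m < n"
    then show "b n (v m) = \<zero>"
      using bspline_at_earlier[of n m] by (auto simp: b_def)
  next
    fix n assume "n \<in> {1..card V}"
    then show "b n (v n) \<noteq> \<zero>"
      using one gen_nonzero l_nonzero by (simp add: b_def bspline_diag)
  next
    fix p n
    assume p: "p \<in> carrier (spline_module R V E \<alpha>)" and n: "n \<in> {1..card V}"
      and vanish: "\<And>m. m \<in> {1..<n} \<Longrightarrow> p (v m) = \<zero>"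
    show "p (v n) \<in> PIdl (b n (v n))"
    proof (cases "n = 1")
      case True
      \<comment> \<open>The leading entry at the first vertex is \<open>\<one>\<close>, whose ideal
        is the whole ring.\<close>
      have "p (v n) \<in> carrier R" using p splines_closed v_mem[OF n] by auto
      moreover have "PIdl \<one> = carrier R"
        using ideal.one_imp_carrier[OF cgenideal_ideal cgenideal_self] by blast
      ultimately show ?thesis
        using one[OF n] True by (simp add: b_def)
    next
      case False
      then show ?thesis
        using p n vanish nb[of n] spline_lead_dvd[of n "nb n" p] by (simp add: b_def)
    qed
  qed
  ultimately show ?thesis by simp
qed

end

theorem theorem3p3:
  fixes R :: "('a, 'm) ring_scheme"
    and V :: "'v set" and E :: "'v set set" and \<alpha> :: "'v set \<Rightarrow> 'a set"
    and i j l :: 'a and v :: "nat \<Rightarrow> 'v"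
  assumes "factorial_domain R"
    and "connected_graph V E"
    and "edge_labeling R E \<alpha>"
    and "i \<in> carrier R" and "j \<in> carrier R"
    and "i \<noteq> \<zero>\<^bsub>R\<^esub>" and "j \<noteq> \<zero>\<^bsub>R\<^esub>"
    and "\<alpha> ` E = {PIdl\<^bsub>R\<^esub> i, PIdl\<^bsub>R\<^esub> j}"
    and "l \<in> carrier R" and "l lcmof\<^bsub>R\<^esub> i j"
    and "vertex_ordering V E v"
  shows "(\<forall>n. 1 < n \<and> n \<le> card V \<longrightarrow>
            (\<forall>m\<in>earlier_nbrs E v n. \<forall>m'\<in>earlier_nbrs E v n.
               basis_spline R V E \<alpha> i j l v n m = basis_spline R V E \<alpha> i j l v n m'))
       \<and> free_module R (spline_module R V E \<alpha>)
       \<and> (\<forall>nb. (\<forall>n. 1 < n \<and> n \<le> card V \<longrightarrow> nb n \<in> earlier_nbrs E v n) \<longrightarrow>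
            module_basis R (spline_module R V E \<alpha>)
              (insert (one_spline R V)
                 {basis_spline R V E \<alpha> i j l v n (nb n) | n. 1 < n \<and> n \<le> card V}))"
proof -
  interpret factorial_domain R by fact
  have graph: "simple_graph V E" and ne: "V \<noteq> {}"
    using assms(2) by (simp_all add: connected_graph_def)
  interpret two_labels R V E \<alpha> i j l v
    by unfold_locales (fact graph assms equalityD1[OF assms(8)])+
  have nbrs: "\<forall>n. 1 < n \<and> n \<le> card V \<longrightarrow> earlier_nbrs E v n \<noteq> {}"
    using assms(11) by (simp add: vertex_ordering_def)
  \<comment> \<open>One particular choice of earlier neighbors exhibits a basis and hence freeness;
    the last claim is then proved for every choice.\<close>
  define nb where "nb n = (SOME m. m \<in> earlier_nbrs E v n)" for n
  have "nb n \<in> earlier_nbrs E v n" if "1 < n" "n \<le> card V" for n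
    using nbrs that unfolding nb_def some_in_eq by simp
  from bspline_basis[OF this ne] have "free_module R (spline_module R V E \<alpha>)"
    using spline_module_is_module[OF graph labeling] by (auto simp: free_module_def)
  moreover have "bspline n m = bspline n m'"
    if "1 < n \<and> n \<le> card V" "m \<in> earlier_nbrs E v n" "m' \<in> earlier_nbrs E v n" for n m m'
    using that by (intro bspline_unique) auto
  moreover have "module_basis R (spline_module R V E \<alpha>)
      (insert (one_spline R V) {bspline n (nb n) | n. 1 < n \<and> n \<le> card V})"
    if "\<forall>n. 1 < n \<and> n \<le> card V \<longrightarrow> nb n \<in> earlier_nbrs E v n" for nb
    using that by (intro bspline_basis ne) simp
  ultimately show ?thesis by (intro conjI allI impI ballI)
qed

end
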